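(* Let $G$ be the fundamental group of the Weeks manifold. Then there is no injective homomorphism $G\to\mathrm{Homeo}(S^1)$; that is, $G$ has no faithful action on the circle.
   Context: The Weeks manifold $W$ is the closed hyperbolic $3$-manifold obtained by $(5/2,5/1)$ Dehn surgery on the Whitehead link (with the convention that $+1$ surgery on a component of this link yields the trefoil). Its fundamental group has the presentation $$G=\langle a,b \mid bababAb^2A,\ ababaBa^2B\rangle,\qquad A=a^{-1},\ B=b^{-1}.$$ $\mathrm{Homeo}(S^1)$ is the group of all (orientation preserving or reversing) homeomorphisms of the circle. *)

theory Defs
  imports "HOL-Analysis.Analysis" "HOL-Algebra.Bij"
begin

section \<open>Groups given by generators and relators\<close>

text \<open>
  The generators are all elements of the type \<open>'a\<close>. The letter \<open>(x, True)\<close> stands for the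
  generator \<open>x\<close> and \<open>(x, False)\<close> for its formal inverse; words need not be reduced.
\<close>

type_synonym 'a word = "('a \<times> bool) list"

inductive pres_eq :: "'a word set \<Rightarrow> 'a word \<Rightarrow> 'a word \<Rightarrow> bool" for R where
  refl: "pres_eq R u u"
| sym: "pres_eq R u v \<Longrightarrow> pres_eq R v u"
| trans: "pres_eq R u v \<Longrightarrow> pres_eq R v w \<Longrightarrow> pres_eq R u w"
| cancel: "pres_eq R (u @ [(x, s), (x, \<not> s)] @ v) (u @ v)"
| relator: "r \<in> R \<Longrightarrow> pres_eq R (u @ r @ v) (u @ v)"

definition pres_rel :: "'a word set \<Rightarrow> ('a word \<times> 'a word) set" where
  "pres_rel R = {(u, v). pres_eq R u v}"

definition presented_group :: "'a word set \<Rightarrow> 'a word set monoid" where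
  "presented_group R =
     \<lparr>carrier = UNIV // pres_rel R,
      mult = \<lambda>X Y. \<Union>u\<in>X. \<Union>v\<in>Y. pres_rel R `` {u @ v},
      one = pres_rel R `` {[]}\<rparr>"

lemma equiv_pres_rel: "equiv UNIV (pres_rel R)"
  by (rule equivI)
    (auto simp: pres_rel_def intro!: refl_onI symI transI
      intro: pres_eq.refl pres_eq.sym pres_eq.trans)

lemma pres_eq_context: "pres_eq R u v \<Longrightarrow> pres_eq R (p @ u @ q) (p @ v @ q)"
proof (induction rule: pres_eq.induct)
  case (cancel u x s v)
  show ?case using pres_eq.cancel[of R "p @ u" x s "v @ q"] by simp
next
  case (relator r u v)
  then show ?case using pres_eq.relator[of r R "p @ u" "v @ q"] by simp
qed (blast intro: pres_eq.refl pres_eq.sym pres_eq.trans)+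

lemma pres_eq_append:
  assumes "pres_eq R u u'" "pres_eq R v v'"
  shows "pres_eq R (u @ v) (u' @ v')"
  using pres_eq_context[OF assms(1), of "[]" v] pres_eq_context[OF assms(2), of u' "[]"]
  by (auto intro: pres_eq.trans)

lemma presented_group_mult:
  "pres_rel R `` {u} \<otimes>\<^bsub>presented_group R\<^esub> pres_rel R `` {v} = pres_rel R `` {u @ v}"
proof -
  have "(\<lambda>u v. pres_rel R `` {u @ v}) respects2 pres_rel R"
    by (rule congruent2I', rule equiv_class_eq[OF equiv_pres_rel])
      (simp add: pres_rel_def pres_eq_append)
  then show ?thesis
    by (simp add: presented_group_def UN_equiv_class2[OF equiv_pres_rel equiv_pres_rel])
qed

lemma pres_eq_inverse: "pres_eq R (rev (map (\<lambda>(x, s). (x, \<not> s)) w) @ w) []"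
proof (induction w)
  case Nil
  show ?case by (simp add: pres_eq.refl)
next
  case (Cons l w)
  obtain x s where l: "l = (x, s)" by force
  show ?case
    using pres_eq.cancel[of R "rev (map (\<lambda>(x, s). (x, \<not> s)) w)" x "\<not> s" w] Cons l
    by (auto intro: pres_eq.trans)
qed

theorem group_presented_group: "group (presented_group R)"
proof (rule groupI)
  have one: "\<one>\<^bsub>presented_group R\<^esub> = pres_rel R `` {[]}"
    by (simp add: presented_group_def)
  have carrier: "carrier (presented_group R) = UNIV // pres_rel R"
    by (simp add: presented_group_def)
  show "\<one>\<^bsub>presented_group R\<^esub> \<in> carrier (presented_group R)"
    by (simp add: one carrier quotientI)
  fix x assume "x \<in> carrier (presented_group R)"
  then obtain u where x: "x = pres_rel R `` {u}" by (auto simp: carrier elim: quotientE)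
  show "\<one>\<^bsub>presented_group R\<^esub> \<otimes>\<^bsub>presented_group R\<^esub> x = x"
    by (simp add: one x presented_group_mult)
  have "pres_rel R `` {rev (map (\<lambda>(x, s). (x, \<not> s)) u)} \<otimes>\<^bsub>presented_group R\<^esub> x
      = \<one>\<^bsub>presented_group R\<^esub>"
    unfolding x one presented_group_mult
    by (rule equiv_class_eq[OF equiv_pres_rel]) (simp add: pres_rel_def pres_eq_inverse)
  then show "\<exists>y\<in>carrier (presented_group R). y \<otimes>\<^bsub>presented_group R\<^esub> x = \<one>\<^bsub>presented_group R\<^esub>"
    by (metis UNIV_I carrier quotientI)
  fix y assume "y \<in> carrier (presented_group R)"
  then obtain v where y: "y = pres_rel R `` {v}" by (auto simp: carrier elim: quotientE)
  show "x \<otimes>\<^bsub>presented_group R\<^esub> y \<in> carrier (presented_group R)"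
    by (simp add: x y presented_group_mult carrier quotientI)
  fix z assume "z \<in> carrier (presented_group R)"
  then obtain w where z: "z = pres_rel R `` {w}" by (auto simp: carrier elim: quotientE)
  show "x \<otimes>\<^bsub>presented_group R\<^esub> y \<otimes>\<^bsub>presented_group R\<^esub> z
      = x \<otimes>\<^bsub>presented_group R\<^esub> (y \<otimes>\<^bsub>presented_group R\<^esub> z)"
    by (simp add: x y z presented_group_mult)
qed


section \<open>The fundamental group of the Weeks manifold\<close>

text \<open>
  The Weeks manifold is \<open>(5/2, 5/1)\<close> Dehn surgery on the Whitehead link; its fundamental group
  is taken here in the form of the presentation
  \<open>\<langle>a, b | bababAb\<^sup>2A, ababaBa\<^sup>2B\<rangle>\<close>, where \<open>A = a\<^sup>-\<^sup>1\<close> and \<open>B = b\<^sup>-\<^sup>1\<close>.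
\<close>

datatype weeks_gen = Gen_a | Gen_b

definition weeks_relators :: "weeks_gen word set" where
  "weeks_relators =
     (let a = (Gen_a, True); b = (Gen_b, True); A = (Gen_a, False); B = (Gen_b, False)
      in {[b, a, b, a, b, A, b, b, A], [a, b, a, b, a, B, a, a, B]})"

definition weeks_group :: "weeks_gen word set monoid" where
  "weeks_group = presented_group weeks_relators"


section \<open>Homeomorphism groups\<close>

text \<open>
  As in \<^const>\<open>BijGroup\<close>, self-maps are made extensional, so that
  a homeomorphism of the space \<open>X\<close> corresponds to exactly one element of the carrier.
\<close>

definition Homeo :: "'a topology \<Rightarrow> ('a \<Rightarrow> 'a) monoid" where
  "Homeo X =
     BijGroup (topspace X) \<lparr>carrier := {f \<in> Bij (topspace X). homeomorphic_map X X f}\<rparr>"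

abbreviation circle :: "complex topology" where
  "circle \<equiv> top_of_set (sphere 0 1)"

lemma subgroup_Homeo:
  "subgroup {f \<in> Bij (topspace X). homeomorphic_map X X f} (BijGroup (topspace X))"
proof (rule group.subgroupI[OF group_BijGroup])
  show "{f \<in> Bij (topspace X). homeomorphic_map X X f} \<subseteq> carrier (BijGroup (topspace X))"
    by (auto simp: BijGroup_def)
  have "homeomorphic_map X X (\<lambda>x\<in>topspace X. x)"
    by (rule homeomorphic_map_eq[of X X id]) auto
  then show "{f \<in> Bij (topspace X). homeomorphic_map X X f} \<noteq> {}"
    using id_Bij by blast
next
  fix f assume f: "f \<in> {f \<in> Bij (topspace X). homeomorphic_map X X f}"
  then obtain g where g: "homeomorphic_maps X X f g"
    by (auto simp: homeomorphic_map_maps)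
  have "homeomorphic_map X X (restrict (inv_into (topspace X) f) (topspace X))"
  proof (rule homeomorphic_map_eq)
    show "homeomorphic_map X X g" using g homeomorphic_maps_map by blast
    fix x assume x: "x \<in> topspace X"
    have "f (g x) = x" "g x \<in> topspace X" "inj_on f (topspace X)"
      using g x f unfolding homeomorphic_maps_def continuous_map_def homeomorphic_map_def by auto
    then show "g x = restrict (inv_into (topspace X) f) (topspace X) x"
      using x by (metis inv_into_f_f restrict_apply')
  qed
  then show "inv\<^bsub>BijGroup (topspace X)\<^esub> f \<in> {f \<in> Bij (topspace X). homeomorphic_map X X f}"
    using f by (simp add: inv_BijGroup restrict_inv_into_Bij)
next
  fix f g
  assume fg: "f \<in> {f \<in> Bij (topspace X). homeomorphic_map X X f}"
             "g \<in> {f \<in> Bij (topspace X). homeomorphic_map X X f}"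
  have "homeomorphic_map X X (compose (topspace X) f g)"
  proof (rule homeomorphic_map_eq)
    show "homeomorphic_map X X (f \<circ> g)" using fg homeomorphic_map_compose by blast
  qed (simp add: compose_def)
  then show "f \<otimes>\<^bsub>BijGroup (topspace X)\<^esub> g \<in> {f \<in> Bij (topspace X). homeomorphic_map X X f}"
    using fg by (simp add: BijGroup_def compose_Bij)
qed

theorem group_Homeo: "group (Homeo X)"
  unfolding Homeo_def
  by (rule group.subgroup_imp_group[OF group_BijGroup subgroup_Homeo])

end

theory Submission
  imports Defs
begin

text \<open>
  Each relator contains one generator an odd and the other an even number of times, so an action
  preserves orientation, and the generators lift to homeomorphisms \<open>f\<^sub>a, f\<^sub>b\<close> of the line that commute
  with the unit translation. The relators lift to translations by integers \<open>i, j\<close>. As they have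
  exponent sums \<open>(0, 5)\<close> and \<open>(5, 0)\<close>, these integers define a homomorphism from the group to
  \<open>\<int>/5\<close> (the Euler class of the action), and over its kernel \<open>K\<close> the action lifts to the line.
  If the action is faithful, then \<open>K\<close> is left-orderable. The automorphisms \<open>(a, b) \<mapsto> (b, a)\<close> and
  \<open>(a, b) \<mapsto> (a, aB)\<close> reduce the seven possible kernels to those containing \<open>b\<close> and to that
  containing \<open>aB\<^sup>2\<close>, where every choice of signs of a few elements makes some product of
  positive elements trivial.
\<close>

section \<open>Positive cones in groups satisfying the relations\<close>

text \<open>The inverses are parameters, so that a symmetry of the presentation is just another
  instance of the locale.\<close>

locale weeks_relations =
  fixes a b A B :: "'g :: monoid_mult"
  assumes inverses: "a * A = 1" "A * a = 1" "b * B = 1" "B * b = 1"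
    and relator_b: "b * a * b * a * b * A * b * b * A = 1"
    and relator_a: "a * b * a * b * a * B * a * a * B = 1"
begin

lemma cancel: "a * (A * x) = x" "A * (a * x) = x" "b * (B * x) = x" "B * (b * x) = x"
  by (simp_all add: inverses flip: mult.assoc)

lemma swap: "weeks_relations b a B A"
  by unfold_locales (simp_all add: inverses relator_a relator_b)

text \<open>The free tail \<open>x\<close> lets the relation rewrite inside right-associated
  words.\<close>

lemma relator_tail: "b * (a * (b * (a * (b * (A * (b * (b * (A * x)))))))) = x"
  using arg_cong[OF relator_b, of "\<lambda>z. z * x"] by (simp add: mult.assoc)

text \<open>These nine identities, used also for the three other generating tuples obtained from \<open>swap\<close>
  and \<open>invert\<close>, replace more than half of a relator by its shorter complement; this Dehn algorithm
  proves all equations between words that are needed.\<close>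

lemma relator_splits:
  "b * (a * (b * (a * (b * x)))) = a * (B * (B * (a * x)))"
  "a * (b * (a * (b * (A * x)))) = B * (a * (B * (B * x)))"
  "b * (a * (b * (A * (b * x)))) = A * (B * (a * (B * x)))"
  "a * (b * (A * (b * (b * x)))) = B * (A * (B * (a * x)))"
  "b * (A * (b * (b * (A * x)))) = A * (B * (A * (B * x)))"
  "A * (b * (b * (A * (b * x)))) = B * (A * (B * (A * x)))"
  "b * (b * (A * (b * (a * x)))) = a * (B * (A * (B * x)))"
  "b * (A * (b * (a * (b * x)))) = B * (a * (B * (A * x)))"
  "A * (b * (a * (b * (a * x)))) = B * (B * (a * (B * x)))"
proof -
  show "b * (a * (b * (a * (b * x)))) = a * (B * (B * (a * x)))"
    \<comment> \<open>Here and below, the tail and the left multiplier are chosen so that free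
      cancellation leaves a piece of the cyclic relator on one side and the inverse of the rest on
      the other.\<close>
    using arg_cong[OF relator_tail[of "a * (B * (B * (a * x)))"], of "\<lambda>z. z"]
    by (simp add: cancel)
  show "a * (b * (a * (b * (A * x)))) = B * (a * (B * (B * x)))"
    using arg_cong[OF relator_tail[of "a * (B * (B * x))"], of "\<lambda>z. B * z"]
    by (simp add: cancel)
  show "b * (a * (b * (A * (b * x)))) = A * (B * (a * (B * x)))"
    using arg_cong[OF relator_tail[of "a * (B * x)"], of "\<lambda>z. A * (B * z)"]
    by (simp add: cancel)
  show "a * (b * (A * (b * (b * x)))) = B * (A * (B * (a * x)))"
    using arg_cong[OF relator_tail[of "a * x"], of "\<lambda>z. B * (A * (B * z))"]
    by (simp add: cancel)
  show "b * (A * (b * (b * (A * x)))) = A * (B * (A * (B * x)))"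
    using arg_cong[OF relator_tail[of "x"], of "\<lambda>z. A * (B * (A * (B * z)))"]
    by (simp add: cancel)
  show "A * (b * (b * (A * (b * x)))) = B * (A * (B * (A * x)))"
    using arg_cong[OF relator_tail[of "a * (B * (B * (a * (B * (A * (B * (A * x)))))))"], of "\<lambda>z. A * (b * (b * (A * z)))"]
    by (simp add: cancel)
  show "b * (b * (A * (b * (a * x)))) = a * (B * (A * (B * x)))"
    using arg_cong[OF relator_tail[of "a * (B * (B * (a * (B * (A * (B * x))))))"], of "\<lambda>z. b * (b * (A * z))"]
    by (simp add: cancel)
  show "b * (A * (b * (a * (b * x)))) = B * (a * (B * (A * x)))"
    using arg_cong[OF relator_tail[of "a * (B * (B * (a * (B * (A * x)))))"], of "\<lambda>z. b * (A * z)"]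
    by (simp add: cancel)
  show "A * (b * (a * (b * (a * x)))) = B * (B * (a * (B * x)))"
    using arg_cong[OF relator_tail[of "a * (B * (B * (a * (B * x))))"], of "\<lambda>z. A * z"]
    by (simp add: cancel)
qed

text \<open>Read backwards, each relator is a cyclic permutation of itself, so inverting all its
  letters gives a conjugate of its inverse.\<close>

lemma invert: "weeks_relations A B a b"
proof unfold_locales
  interpret swap: weeks_relations b a B A by (rule swap)
  show "B * A * B * A * B * a * B * B * a = 1"
    by (simp only: mult.assoc relator_splits(5)[of "a * (B * (B * a))", symmetric] cancel inverses)
  show "A * B * A * B * A * b * A * A * b = 1"
    by (simp only: mult.assoc swap.relator_splits(5)[of "b * (A * (A * b))", symmetric] cancel inverses)
qed (simp_all add: inverses)

lemmas word_simps = mult.assoc cancel inverses relator_splits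
  weeks_relations.relator_splits[OF swap]
  weeks_relations.relator_splits[OF invert]
  weeks_relations.relator_splits[OF weeks_relations.swap[OF invert]]

text \<open>With \<open>swap\<close>, this change of generators carries the exclusion of two kinds
  of kernels over to all kernels.\<close>

lemma shear: "weeks_relations a (a * B) A (b * A)"
proof unfold_locales
  show "a * B * a * (a * B) * a * (a * B) * A * (a * B) * (a * B) * A = 1"
    by (simp add: word_simps)
  show "a * (a * B) * a * (a * B) * a * (b * A) * a * a * (b * A) = 1"
    by (simp add: word_simps)
qed (simp_all add: word_simps)

end

text \<open>\<open>P\<close> stands for the positive cone of a left-order on a subgroup. That an
  element or its inverse is positive holds only inside the subgroup, and so enters as a hypothesis
  on single elements.\<close>

locale weeks_cone = weeks_relations a b A B for a b A B :: "'g :: monoid_mult" +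
  fixes P :: "'g \<Rightarrow> bool"
  assumes mult: "P x \<Longrightarrow> P y \<Longrightarrow> P (x * y)"
    and not_one: "\<not> P 1"
begin

text \<open>The equation carries a tail \<open>w\<close> because the rewrite rules match only words
  followed by a tail.\<close>

lemma step:
  assumes "P x" "P y" "\<And>w. x * y * w = z * w"
  shows "P z"
  using mult[OF assms(1,2)] assms(3)[of 1] by simp

text \<open>Dehn rewriting gives no normal forms, so equal words may reduce differently; here
  \<open>x * y = z\<close> is checked in the form \<open>x = z * y'\<close>, with \<open>y'\<close>
  the inverse of \<open>y\<close>.\<close>

lemma step_right:
  assumes "P x" "P y" "\<And>w. x * w = z * (y' * w)" "\<And>w. y' * (y * w) = w"
  shows "P z"
proof (rule step[OF assms(1,2)])
  show "x * y * w = z * w" for w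
    using assms(3)[of "y * w"] by (simp add: assms(4) mult.assoc)
qed

lemma absurd3:
  assumes "P x" "P y" "P z" "\<And>w. x * y * z * w = w"
  shows False
  using mult[OF mult[OF assms(1,2)] assms(3)] assms(4)[of 1] not_one by simp

text \<open>The following derivations were found by a computer search. Each step exhibits an element of
  \<open>P\<close> as a product of two earlier ones, and at the end three elements of \<open>P\<close> have product \<open>1\<close>.\<close>

lemma no_cone_b_abAb:
  assumes "P b" "P (a * b * A * b)"
  shows False
proof -
  have p1: "P (A * B * a * B)"
    by (rule step[OF assms(1) assms(2)]) (simp_all add: word_simps)
  have p2: "P (A * B * a)"
    by (rule step[OF p1 assms(1)]) (simp_all add: word_simps)
  have p3: "P (A * B * a * b)"
    by (rule step[OF p2 assms(1)]) (simp_all add: word_simps)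
  have p4: "P (A * B * B * a * B)"
    by (rule step[OF p3 assms(2)]) (simp_all add: word_simps)
  have p5: "P (A * A * b * a * a)"
    by (rule step[OF p4 p2]) (simp_all add: word_simps)
  have p6: "P (b * A * A * b * a * a)"
    by (rule step[OF assms(1) p5]) (simp_all add: word_simps)
  have p7: "P (A * A * b * a * B * a)"
    by (rule step[OF p5 p2]) (simp_all add: word_simps)
  have p8: "P (a * b * b * A)"
    by (rule step_right[OF p6 p7, where y' = "A * b * A * B * a * a"]) (simp_all add: word_simps)
  have p9: "P (a * b * b * b * A * b)"
    by (rule step[OF p8 assms(2)]) (simp_all add: word_simps)
  have p10: "P (a * b * a * a * a * a)"
    by (rule step[OF p9 p6]) (simp_all add: word_simps)
  show False
    by (rule absurd3[OF p10 p3 p9]) (simp add: word_simps)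
qed

lemma no_cone_b_BaBA:
  assumes "P b" "P (B * a * B * A)"
  shows False
proof -
  have p1: "P (a * B * A)"
    by (rule step[OF assms(1) assms(2)]) (simp_all add: word_simps)
  have p2: "P (B * a * B * B * A)"
    by (rule step[OF assms(2) p1]) (simp_all add: word_simps)
  have p3: "P (a * a * b * A * A)"
    by (rule step[OF p1 p2]) (simp_all add: word_simps)
  have p4: "P (a * a * b * A * B * A)"
    by (rule step[OF p3 p1]) (simp_all add: word_simps)
  have p5: "P (a * a * b * b * A * A)"
    by (rule step[OF p3 p3]) (simp_all add: word_simps)
  have p6: "P (B * A * b * b * a * B)"
    by (rule step_right[OF assms(2) p5, where y' = "a * a * B * B * A * A"]) (simp_all add: word_simps)
  have p7: "P (B * A * b * b * a)"
    by (rule step[OF p6 assms(1)]) (simp_all add: word_simps)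
  have p8: "P (a * a * a * a * b * a)"
    by (rule step[OF p4 p7]) (simp_all add: word_simps)
  have p9: "P (b * b)"
    by (rule step[OF assms(1) assms(1)]) (simp_all add: word_simps)
  have p10: "P (b * A * b * b * a * B)"
    by (rule step[OF p9 p6]) (simp_all add: word_simps)
  show False
    by (rule absurd3[OF p2 p8 p10]) (simp add: word_simps)
qed

lemma no_cone_BaB_aBaBA:
  assumes "P (B * a * B)" "P (a * B * a * B * A)"
  shows False
proof -
  have p1: "P (a * a * b)"
    by (rule step[OF assms(2) assms(2)]) (simp_all add: word_simps)
  have p2: "P (a * a * a * B)"
    by (rule step[OF p1 assms(1)]) (simp_all add: word_simps)
  have p3: "P (a * b * a)"
    by (rule step[OF assms(1) assms(1)]) (simp_all add: word_simps)
  have p4: "P (a * b * A * B)"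
    by (rule step[OF p2 p3]) (simp_all add: word_simps)
  have p5: "P (a * B * B)"
    by (rule step[OF assms(2) p4]) (simp_all add: word_simps)
  have p6: "P (A * b * A * A)"
    by (rule step[OF p5 p5]) (simp_all add: word_simps)
  have p7: "P (A * b * A * b * a)"
    by (rule step[OF p6 p3]) (simp_all add: word_simps)
  have p8: "P (A * A * B)"
    by (rule step[OF p7 p7]) (simp_all add: word_simps)
  have p9: "P (A * b * b)"
    by (rule step[OF p6 p1]) (simp_all add: word_simps)
  have p10: "P (a * B * A * B * a)"
    by (rule step[OF p1 p9]) (simp_all add: word_simps)
  show False
    by (rule absurd3[OF p8 p5 p10]) (simp add: word_simps)
qed

lemma no_cone_BaB_abAbA_aBB:
  assumes "P (B * a * B)" "P (a * b * A * b * A)" "P (a * B * B)"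
  shows False
proof -
  have p1: "P (A * b * A * A)"
    by (rule step[OF assms(3) assms(3)]) (simp_all add: word_simps)
  have p2: "P (a * b * a)"
    by (rule step[OF assms(1) assms(1)]) (simp_all add: word_simps)
  have p3: "P (A * b * A * b * a)"
    by (rule step[OF p1 p2]) (simp_all add: word_simps)
  have p4: "P (A * B * a * a * B)"
    by (rule step[OF p3 p1]) (simp_all add: word_simps)
  have p5: "P (A * A * A * b)"
    by (rule step[OF p4 assms(1)]) (simp_all add: word_simps)
  have p6: "P (B * A * B * a * a)"
    by (rule step[OF assms(2) p2]) (simp_all add: word_simps)
  have p7: "P (B * A * b * a)"
    by (rule step[OF assms(2) p6]) (simp_all add: word_simps)
  have p8: "P (B * B * A * B)"
    by (rule step[OF p7 p3]) (simp_all add: word_simps)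
  have p9: "P (B * a * b * A)"
    by (rule step[OF p8 assms(3)]) (simp_all add: word_simps)
  have p10: "P (A * A * b * A)"
    by (rule step[OF p5 p9]) (simp_all add: word_simps)
  show False
    by (rule absurd3[OF p10 p6 p5]) (simp add: word_simps)
qed

lemma no_cone_BaB_abAbA_bbA:
  assumes "P (B * a * B)" "P (a * b * A * b * A)" "P (b * b * A)"
  shows False
proof -
  have p1: "P (B * A * A)"
    by (rule step[OF assms(2) assms(2)]) (simp_all add: word_simps)
  have p2: "P (a * a * B * a)"
    by (rule step[OF assms(3) assms(3)]) (simp_all add: word_simps)
  have p3: "P (B * B * a)"
    by (rule step[OF p1 p2]) (simp_all add: word_simps)
  have p4: "P (a * b * a)"
    by (rule step[OF assms(1) assms(1)]) (simp_all add: word_simps)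
  have p5: "P (A * b * a * b * A)"
    by (rule step[OF p3 p1]) (simp_all add: word_simps)
  have p6: "P (A * A * B)"
    by (rule step[OF p5 assms(3)]) (simp_all add: word_simps)
  have p7: "P (a * b * A * B)"
    by (rule step[OF p4 p6]) (simp_all add: word_simps)
  have p8: "P (B * A * B * B)"
    by (rule step[OF assms(2) p7]) (simp_all add: word_simps)
  have p9: "P (A * A * b * A)"
    by (rule step[OF p6 assms(3)]) (simp_all add: word_simps)
  have p10: "P (B * a * a * B * A)"
    by (rule step[OF p9 assms(2)]) (simp_all add: word_simps)
  have p11: "P (b * A * A * A)"
    by (rule step[OF assms(1) p10]) (simp_all add: word_simps)
  have p12: "P (b * A * B * a)"
    by (rule step[OF p11 p2]) (simp_all add: word_simps)
  show False
    by (rule absurd3[OF p3 p8 p12]) (simp add: word_simps)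
qed

text \<open>Inverting the letters while keeping \<open>P\<close> halves the number of sign
  cases.\<close>

lemma cone_invert: "weeks_cone A B a b P"
  using invert weeks_cone_axioms unfolding weeks_cone_def by blast

text \<open>If \<open>P b\<close>, both alternatives of the second hypothesis are excluded above; if
  \<open>P B\<close>, those of the third are, after inversion of the letters.\<close>

lemma no_cone_b:
  assumes "P b \<or> P B" "P (a * b * A * b) \<or> P (B * a * B * A)" "P (A * B * a * B) \<or> P (b * A * b * a)"
  shows False
proof -
  interpret inverse: weeks_cone A B a b P by (rule cone_invert)
  show False
    using assms no_cone_b_abAb no_cone_b_BaBA inverse.no_cone_b_abAb inverse.no_cone_b_BaBA by blast
qed

text \<open>Up to inversion of the letters, \<open>P (B * a * B)\<close>. The second hypothesis then
  gives a contradiction at once or leaves the two cases of the third; the last two hypotheses are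
  the images of these under inversion.\<close>

lemma no_cone_BaB:
  assumes "P (B * a * B) \<or> P (b * A * b)"
    and "P (a * B * a * B * A) \<or> P (a * b * A * b * A)" "P (a * B * B) \<or> P (b * b * A)"
    and "P (A * b * A * b * a) \<or> P (A * B * a * B * a)" "P (A * b * b) \<or> P (B * B * a)"
  shows False
proof -
  interpret inverse: weeks_cone A B a b P by (rule cone_invert)
  show False
    using assms no_cone_BaB_aBaBA no_cone_BaB_abAbA_aBB no_cone_BaB_abAbA_bbA
      inverse.no_cone_BaB_aBaBA inverse.no_cone_BaB_abAbA_aBB inverse.no_cone_BaB_abAbA_bbA by blast
qed

end

section \<open>Lifts of circle homeomorphisms to the line\<close>

definition circ :: "real \<Rightarrow> complex" where
  "circ x = cis (2 * pi * x)"

lemma norm_circ [simp]: "norm (circ x) = 1"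
  by (simp add: circ_def)

lemma sphere_circE:
  assumes "z \<in> sphere 0 1"
  obtains x where "z = circ x"
proof
  show "z = circ (Arg z / (2 * pi))"
    using assms Arg_eq[of z] by (cases "z = 0") (auto simp: circ_def cis_conv_exp mult.commute)
qed

lemma circ_eq_iff: "circ x = circ y \<longleftrightarrow> (\<exists>n :: int. x = y + of_int n)"
proof -
  have "circ x = circ y \<longleftrightarrow> (\<exists>n :: int. 2 * pi * x = 2 * pi * y + 2 * pi * of_int n)"
    unfolding circ_def cis.code complex.inject using sin_cos_eq_iff[of "2 * pi * x" "2 * pi * y"] by auto
  also have "\<dots> \<longleftrightarrow> (\<exists>n :: int. x = y + of_int n)"
    by (simp flip: distrib_left)
  finally show ?thesis .
qed

lemma circ_add_of_int [simp]: "circ (x + of_int n) = circ x"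
  by (auto simp: circ_eq_iff)

lemma continuous_on_circ: "continuous_on S circ"
  unfolding circ_def by (intro continuous_intros)

definition circle_lift :: "(complex \<Rightarrow> complex) \<Rightarrow> (real \<Rightarrow> real) \<Rightarrow> bool" where
  "circle_lift h f \<longleftrightarrow> continuous_on UNIV f \<and> (\<forall>x. h (circ x) = circ (f x))"

lemma circle_lift_id: "(\<And>z. z \<in> sphere 0 1 \<Longrightarrow> h z = z) \<Longrightarrow> circle_lift h (\<lambda>x. x)"
  by (simp add: circle_lift_def continuous_on_id)

lemma circle_lift_comp:
  assumes "circle_lift h f" "circle_lift k g"
    and "\<And>z. z \<in> sphere 0 1 \<Longrightarrow> l z = h (k z)"
  shows "circle_lift l (\<lambda>x. f (g x))"
  using assms unfolding circle_lift_def
  by (auto intro: continuous_on_compose2[of UNIV f UNIV g])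

text \<open>The line is contractible, so \<open>h (circ x)\<close> has a continuous logarithm; its
  imaginary part over \<open>2 * pi\<close> is a lift.\<close>

lemma circle_lift_exists:
  assumes "continuous_map circle circle h"
  obtains f where "circle_lift h f"
proof -
  have cont: "continuous_on (sphere 0 1) h" and im: "h \<in> sphere 0 1 \<rightarrow> sphere 0 1"
    using assms by auto
  have "continuous_on UNIV (\<lambda>x. h (circ x))"
    by (rule continuous_on_compose2[OF cont continuous_on_circ]) (simp add: image_subset_iff)
  moreover have n: "norm (h (circ x)) = 1" for x
    using im by (auto simp: Pi_iff)
  moreover have "h (circ x) \<noteq> 0" for x
    using n[of x] by auto
  ultimately obtain g where g: "continuous_on UNIV g" "\<And>x. h (circ x) = exp (g x)"
    using continuous_logarithm_on_contractible[of UNIV "\<lambda>x. h (circ x)"] by auto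
  have "circle_lift h (\<lambda>x. Im (g x) / (2 * pi))"
    unfolding circle_lift_def
  proof (intro conjI allI)
    show "continuous_on UNIV (\<lambda>x. Im (g x) / (2 * pi))"
      using g(1) by (intro continuous_intros) auto
    fix x
    have "Re (g x) = 0"
      using n[of x] g(2)[of x] by simp
    then show "h (circ x) = circ (Im (g x) / (2 * pi))"
      using g(2)[of x] exp_eq_polar[of "g x"] by (simp add: circ_def)
  qed
  then show thesis by (rule that)
qed

text \<open>The difference of two lifts is continuous with values in the discrete set of integers,
  hence constant.\<close>

lemma circle_lift_unique:
  assumes "circle_lift h f" "circle_lift h g"
  obtains n :: int where "\<And>x. f x = g x + of_int n"
proof -
  have int: "\<exists>n :: int. f x - g x = of_int n" for x
    using assms circ_eq_iff[of "f x" "g x"] unfolding circle_lift_def by force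
  have "(\<lambda>x. f x - g x) constant_on UNIV"
  proof (rule continuous_discrete_range_constant)
    show "continuous_on UNIV (\<lambda>x. f x - g x)"
      using assms unfolding circle_lift_def by (intro continuous_intros) auto
    fix x
    have "1 \<le> norm ((f y - g y) - (f x - g x))" if "f y - g y \<noteq> f x - g x" for y
    proof -
      obtain m n :: int where mn: "f y - g y = of_int m" "f x - g x = of_int n"
        using int by meson
      then have "1 \<le> \<bar>m - n\<bar>" using that by auto
      then show ?thesis unfolding mn by (metis of_int_1_le_iff of_int_abs of_int_diff real_norm_def)
    qed
    then show "\<exists>e>0. \<forall>y. y \<in> UNIV \<and> f y - g y \<noteq> f x - g x \<longrightarrow> e \<le> norm ((f y - g y) - (f x - g x))"
      by (intro exI[of _ 1]) auto
  qed simp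
  then obtain c where c: "\<And>x. f x - g x = c"
    unfolding constant_on_def by auto
  obtain n :: int where "c = of_int n" using int[of 0] c[of 0] by auto
  then have "f x = g x + of_int n" for x using c[of x] by simp
  then show thesis by (rule that)
qed

text \<open>Precomposing with the unit translation gives another lift of \<open>h\<close>; the
  integer \<open>d\<close> between the two is the degree of \<open>h\<close>.\<close>

lemma circle_lift_shift:
  assumes "circle_lift h f"
  obtains d :: int where "\<And>x. f (x + 1) = f x + of_int d"
proof -
  have "circle_lift h (\<lambda>x. f (x + 1))"
    unfolding circle_lift_def
  proof (intro conjI allI)
    show "continuous_on UNIV (\<lambda>x. f (x + 1))"
      using assms unfolding circle_lift_def
      by (auto intro: continuous_on_compose2[of UNIV f] intro!: continuous_intros)
    show "h (circ x) = circ (f (x + 1))" for x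
    proof -
      have "h (circ (x + 1)) = circ (f (x + 1))"
        using assms unfolding circle_lift_def by blast
      then show ?thesis using circ_add_of_int[of x 1] by simp
    qed
  qed
  then show thesis
    using that by (rule circle_lift_unique[OF _ assms])
qed

lemma shift_of_int:
  fixes f :: "real \<Rightarrow> real"
  assumes "\<And>x. f (x + 1) = f x + of_int d"
  shows "f (x + of_int n) = f x + of_int (n * d)"
proof (induction n rule: int_induct[where k = 0])
  case (step1 i)
  then show ?case using assms[of "x + of_int i"] by (simp add: algebra_simps)
next
  case (step2 i)
  then show ?case using assms[of "x + of_int (i - 1)"] by (simp add: algebra_simps)
qed simp

text \<open>A lift \<open>g\<close> of the inverse map inverts \<open>f\<close> up to integer
  translations on either side, which makes \<open>f\<close> bijective and its degree a unit.\<close>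

lemma circle_lift_homeomorphism:
  assumes "homeomorphic_maps circle circle h k" "circle_lift h f"
  shows "bij f" "circle_lift k (inv_into UNIV f)"
    and "\<exists>s :: int. (s = 1 \<or> s = -1) \<and> (\<forall>x. f (x + 1) = f x + of_int s)"
proof -
  have hk: "h (k z) = z" "k (h z) = z" if "z \<in> sphere 0 1" for z
    using assms(1) that unfolding homeomorphic_maps_def by auto
  have "continuous_map circle circle k"
    using assms(1) unfolding homeomorphic_maps_def by blast
  then obtain g where g: "circle_lift k g" by (rule circle_lift_exists)
  obtain m :: int where m: "\<And>x. g (f x) = x + of_int m"
  proof (rule circle_lift_unique)
    show "circle_lift (\<lambda>z. z) (\<lambda>x. g (f x))"
      by (rule circle_lift_comp[OF g assms(2)]) (simp add: hk)
  qed (rule circle_lift_id, auto)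
  obtain n :: int where n: "\<And>x. f (g x) = x + of_int n"
  proof (rule circle_lift_unique)
    show "circle_lift (\<lambda>z. z) (\<lambda>x. f (g x))"
      by (rule circle_lift_comp[OF assms(2) g]) (simp add: hk)
  qed (rule circle_lift_id, auto)
  have "inj f"
    by (rule injI) (metis add_right_cancel m)
  moreover have "surj f"
    by (rule surjI[of f "\<lambda>y. g (y - of_int n)"]) (simp add: n)
  ultimately show "bij f" by (simp add: bij_def)
  have inv: "inv_into UNIV f = (\<lambda>x. g x + of_int (- m))"
  proof
    fix x
    obtain y where "x = f y" using \<open>surj f\<close> by blast
    then show "inv_into UNIV f x = g x + of_int (- m)"
      using \<open>inj f\<close> m by simp
  qed
  show "circle_lift k (inv_into UNIV f)"
    unfolding inv circle_lift_def
  proof (intro conjI allI)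
    show "continuous_on UNIV (\<lambda>x. g x + of_int (- m))"
      using g unfolding circle_lift_def by (intro continuous_intros) auto
    show "k (circ x) = circ (g x + of_int (- m))" for x
      using g unfolding circle_lift_def circ_add_of_int by blast
  qed
  obtain d :: int where d: "\<And>x. f (x + 1) = f x + of_int d"
    using circle_lift_shift[OF assms(2)] by blast
  obtain e :: int where e: "\<And>x. g (x + 1) = g x + of_int e"
    using circle_lift_shift[OF g] by blast
  \<comment> \<open>The composite of \<open>g\<close> and \<open>f\<close> is a translation, so it
    grows by 1 from 0 to 1; by the degrees it grows by \<open>d * e\<close>.\<close>
  have "(1 :: real) = of_int (d * e)"
    using m[of 1] m[of 0] d[of 0] shift_of_int[of g e, OF e, of "f 0" d] by simp
  then have "d * e = 1" by (metis of_int_eq_1_iff)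
  then show "\<exists>s :: int. (s = 1 \<or> s = -1) \<and> (\<forall>x. f (x + 1) = f x + of_int s)"
    using d zmult_eq_1_iff by blast
qed

text \<open>A continuous injection is monotone on an interval, and the endpoints \<open>x\<close>
  and \<open>x + n\<close> show the direction.\<close>

lemma circle_lift_strict_mono:
  assumes "circle_lift h f" "inj f" "\<And>x. f (x + 1) = f x + 1"
  shows "strict_mono f"
proof (rule strict_monoI)
  fix x y :: real
  assume "x < y"
  obtain n :: nat where "y - x < of_nat n" using reals_Archimedean2 by blast
  then have n: "y < x + of_int (int n)" by simp
  have "f (x + of_int (int n)) = f x + of_int (int n)"
    using shift_of_int[of f 1 x "int n"] assms(3) by simp
  then have "f x < f (x + of_int (int n))" using n \<open>x < y\<close> by simp
  moreover have "continuous_on {x..x + of_int (int n)} f"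
    using assms(1) continuous_on_subset unfolding circle_lift_def by blast
  moreover have "inj_on f {x..x + of_int (int n)}"
    using assms(2) inj_on_subset by blast
  ultimately show "f x < f y"
    using continuous_inj_imp_mono[of x y "x + of_int (int n)" f] \<open>x < y\<close> n by linarith
qed

section \<open>The group as a type\<close>

text \<open>\<open>relator g\<close> is the relator in which \<open>g\<close> has exponent sum \<open>5\<close>.\<close>

definition relator :: "weeks_gen \<Rightarrow> weeks_gen word" where
  "relator g =
     (let h = (case g of Gen_a \<Rightarrow> Gen_b | Gen_b \<Rightarrow> Gen_a)
      in [(g, True), (h, True), (g, True), (h, True), (g, True), (h, False), (g, True), (g, True), (h, False)])"

lemma weeks_relators_eq: "weeks_relators = range relator"
proof -
  have "UNIV = {Gen_b, Gen_a}"
    using weeks_gen.exhaust by auto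
  then have "range relator = {relator Gen_b, relator Gen_a}"
    by (metis image_empty image_insert)
  then show ?thesis
    by (simp add: weeks_relators_def relator_def Let_def)
qed

definition expo :: "weeks_gen \<Rightarrow> weeks_gen word \<Rightarrow> int" where
  "expo g w = (\<Sum>(x, s)\<leftarrow>w. if x = g then if s then 1 else -1 else 0)"

lemma expo_simps [simp]:
  "expo g [] = 0"
  "expo g ((x, s) # w) = (if x = g then if s then 1 else -1 else 0) + expo g w"
  "expo g (u @ v) = expo g u + expo g v"
  by (simp_all add: expo_def)

lemma expo_relator: "expo g (relator h) = (if g = h then 5 else 0)"
  by (cases g; cases h) (simp_all add: relator_def)

text \<open>The relators have exponent sums 0 and 5. Exponent sums modulo 5 are therefore invariants
  of group elements and serve to show that words are nontrivial.\<close>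

lemma pres_eq_expo: "pres_eq weeks_relators u v \<Longrightarrow> 5 dvd expo g u - expo g v"
proof (induction rule: pres_eq.induct)
  case (sym u v)
  then show ?case by (simp add: dvd_diff_commute)
next
  case (trans u v w)
  then show ?case using dvd_add by fastforce
next
  case (relator r u v)
  then obtain h where "r = relator h" by (auto simp: weeks_relators_eq)
  then show ?case by (simp add: expo_relator)
qed auto

definition formal_inverse :: "'a word \<Rightarrow> 'a word" where
  "formal_inverse w = rev (map (\<lambda>(x, s). (x, \<not> s)) w)"

\<comment> \<open>The congruence is that of \<open>weeks_group\<close>; a type of class
  \<open>monoid_mult\<close> makes the rewriting of words in \<open>weeks_relations\<close>
  available.\<close>
quotient_type weeks = "weeks_gen word" / "pres_eq weeks_relators"
  by (intro equivpI reflpI sympI transpI) (auto intro: pres_eq.refl pres_eq.sym pres_eq.trans)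

instantiation weeks :: monoid_mult
begin

lift_definition one_weeks :: weeks is "[]" .

lift_definition times_weeks :: "weeks \<Rightarrow> weeks \<Rightarrow> weeks" is "(@)"
  by (rule pres_eq_append)

instance
  by standard (transfer; simp add: pres_eq.refl)+

end

lift_definition generator :: "weeks_gen \<times> bool \<Rightarrow> weeks" is "\<lambda>l. [l]" .

lemma abs_weeks_word: "abs_weeks w = prod_list (map generator w)"
proof (induction w)
  case Nil
  show ?case by (simp add: one_weeks_def)
next
  case (Cons l w)
  have "abs_weeks (l # w) = generator l * abs_weeks w"
    by (simp add: generator.abs_eq times_weeks.abs_eq)
  then show ?case by (simp add: Cons)
qed

lemma generator_inverse: "generator (x, s) * generator (x, \<not> s) = 1"
  by transfer (use pres_eq.cancel[of _ "[]" _ _ "[]"] in auto)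

lemma weeks_relations_generators:
  "weeks_relations (generator (Gen_a, True)) (generator (Gen_b, True))
     (generator (Gen_a, False)) (generator (Gen_b, False))"
proof
  have rel: "prod_list (map generator (relator g)) = 1" for g
  proof -
    have "pres_eq weeks_relators ([] @ relator g @ []) ([] @ [])"
      by (rule pres_eq.relator) (simp add: weeks_relators_eq)
    then show ?thesis
      by (simp flip: abs_weeks_word add: one_weeks_def weeks.abs_eq_iff)
  qed
  show "generator (Gen_b, True) * generator (Gen_a, True) * generator (Gen_b, True) *
      generator (Gen_a, True) * generator (Gen_b, True) * generator (Gen_a, False) *
      generator (Gen_b, True) * generator (Gen_b, True) * generator (Gen_a, False) = 1"
    using rel[of Gen_b] by (simp add: relator_def mult.assoc)
  show "generator (Gen_a, True) * generator (Gen_b, True) * generator (Gen_a, True) *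
      generator (Gen_b, True) * generator (Gen_a, True) * generator (Gen_b, False) *
      generator (Gen_a, True) * generator (Gen_a, True) * generator (Gen_b, False) = 1"
    using rel[of Gen_a] by (simp add: relator_def mult.assoc)
qed (use generator_inverse[of _ True] generator_inverse[of _ False] in simp_all)

section \<open>Signs of increasing bijections\<close>

text \<open>This is the positive cone of the standard left-order on order-preserving bijections of a
  line: well-order the points by \<open>r\<close> and read the sign at the first point
  moved.\<close>

definition first_moved_up :: "'a rel \<Rightarrow> ('a \<Rightarrow> 'a :: order) \<Rightarrow> bool" where
  "first_moved_up r f \<longleftrightarrow> (\<exists>x. x < f x \<and> (\<forall>y. (y, x) \<in> r - Id \<longrightarrow> f y = y))"

text \<open>At the \<open>r\<close>-earlier of the two first moved points, one map moves up and the
  other moves up or fixes the point, while both fix all earlier points.\<close>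

lemma first_moved_up_comp:
  assumes r: "well_order r" and mono: "strict_mono f" "strict_mono g"
    and "first_moved_up r f" "first_moved_up r g"
  shows "first_moved_up r (f \<circ> g)"
proof -
  obtain x where x: "x < f x" "\<And>y. (y, x) \<in> r - Id \<Longrightarrow> f y = y"
    using assms(4) unfolding first_moved_up_def by blast
  obtain z where z: "z < g z" "\<And>y. (y, z) \<in> r - Id \<Longrightarrow> g y = y"
    using assms(5) unfolding first_moved_up_def by blast
  have total: "(y, w) \<in> r - Id \<or> y = w \<or> (w, y) \<in> r - Id" for y w
    using r unfolding well_order_on_def linear_order_on_def total_on_def by blast
  have trans: "(y, w) \<in> r - Id \<Longrightarrow> (w, v) \<in> r - Id \<Longrightarrow> (y, v) \<in> r - Id" for y w v
    using r unfolding well_order_on_def linear_order_on_def partial_order_on_def preorder_on_def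
    by (metis Diff_iff antisymD pair_in_Id_conv transD)
  consider "(x, z) \<in> r - Id" | "x = z" | "(z, x) \<in> r - Id" using total by blast
  then show ?thesis
  proof cases
    case 1
    then show ?thesis unfolding first_moved_up_def o_def
      using x z(2) trans by (metis (no_types, lifting))
  next
    case 2
    have "x < f (g x)" using x(1) z(1) 2 mono(1) by (metis less_trans strict_monoD)
    then show ?thesis unfolding first_moved_up_def o_def
      using x(2) z(2) 2 by metis
  next
    case 3
    have "z < f (g z)" using z(1) x(2)[OF 3] mono(1) by (metis less_trans strict_monoD)
    then show ?thesis unfolding first_moved_up_def o_def
      using x(2) z(2) trans 3 by metis
  qed
qed

text \<open>If \<open>f\<close> moves its first moved point \<open>z\<close> down, applying the
  increasing \<open>g\<close> to \<open>f z < z\<close> gives \<open>z < g z\<close>.\<close>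

lemma first_moved_up_total:
  fixes f :: "'a \<Rightarrow> 'a :: linorder"
  assumes r: "well_order r" and mono: "strict_mono g" and inv: "\<And>x. g (f x) = x"
    and "f x \<noteq> x"
  shows "first_moved_up r f \<or> first_moved_up r g"
proof -
  have "wf (r - Id)"
    using r unfolding well_order_on_def by blast
  then obtain z where z: "f z \<noteq> z" "\<And>y. (y, z) \<in> r - Id \<Longrightarrow> f y = y"
    using wfE_min[of "r - Id" x "{x. f x \<noteq> x}"] assms(4) by auto
  show ?thesis
  proof (cases "z < f z")
    case True
    then show ?thesis using z(2) unfolding first_moved_up_def by blast
  next
    case False
    then have "g (f z) < g z" using z(1) mono by (metis linorder_neqE strict_monoD)
    then have "z < g z" by (simp add: inv)
    moreover have "g y = y" if "(y, z) \<in> r - Id" for y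
      using z(2)[OF that] inv[of y] by simp
    ultimately show ?thesis unfolding first_moved_up_def by blast
  qed
qed

section \<open>Formal inverses of words\<close>

lemma formal_inverse_simps [simp]:
  "formal_inverse [] = []"
  "formal_inverse ((x, s) # w) = formal_inverse w @ [(x, \<not> s)]"
  "formal_inverse (u @ v) = formal_inverse v @ formal_inverse u"
  by (simp_all add: formal_inverse_def)

lemma formal_inverse_formal_inverse [simp]: "formal_inverse (formal_inverse w) = w"
  by (induction w) auto

lemma expo_formal_inverse [simp]: "expo g (formal_inverse w) = - expo g w"
  by (induction w) auto

lemma abs_weeks_append: "abs_weeks (u @ v) = abs_weeks u * abs_weeks v"
  by (simp add: times_weeks.abs_eq)

section \<open>Faithful actions on the circle\<close>

locale faithful_weeks_action =
  fixes \<phi> :: "weeks_gen word set \<Rightarrow> complex \<Rightarrow> complex"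
  assumes hom: "\<phi> \<in> hom weeks_group (Homeo circle)"
    and inj: "inj_on \<phi> (carrier weeks_group)"
begin

definition act :: "weeks_gen word \<Rightarrow> complex \<Rightarrow> complex" where
  "act w = \<phi> (pres_rel weeks_relators `` {w})"

lemma class_in_carrier: "pres_rel weeks_relators `` {w} \<in> carrier weeks_group"
  by (simp add: weeks_group_def presented_group_def quotientI)

lemma act_in_Bij: "act w \<in> Bij (sphere 0 1)"
  and homeomorphic_map_act: "homeomorphic_map circle circle (act w)"
  using hom_in_carrier[OF hom class_in_carrier, of w] by (auto simp: act_def Homeo_def)

lemma act_append:
  assumes "z \<in> sphere 0 1"
  shows "act (u @ v) z = act u (act v z)"
proof -
  have "act (u @ v) = act u \<otimes>\<^bsub>Homeo circle\<^esub> act v"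
    using hom_mult[OF hom class_in_carrier class_in_carrier, of u v]
    by (simp add: act_def weeks_group_def presented_group_mult)
  then show ?thesis
    using assms act_in_Bij by (simp add: Homeo_def BijGroup_def compose_eq)
qed

lemma act_Nil:
  assumes "z \<in> sphere 0 1"
  shows "act [] z = z"
proof -
  have "act [] = \<one>\<^bsub>Homeo circle\<^esub>"
    using hom_one[OF hom _ group_Homeo] group_presented_group[of weeks_relators]
    by (simp add: act_def weeks_group_def presented_group_def)
  then show ?thesis
    using assms by (simp add: Homeo_def BijGroup_def)
qed

lemma act_cong:
  assumes "pres_eq weeks_relators u v"
  shows "act u = act v"
  using equiv_class_eq[OF equiv_pres_rel, of u v weeks_relators] assms
  by (simp add: act_def pres_rel_def)

lemma act_faithful:
  assumes "\<And>z. z \<in> sphere 0 1 \<Longrightarrow> act w z = z"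
  shows "pres_eq weeks_relators w []"
proof -
  have "act w = act []"
    using act_in_Bij[of w] act_in_Bij[of "[]"] assms act_Nil
    unfolding Bij_def by (intro extensionalityI[of _ "sphere 0 1"]) auto
  then have "pres_rel weeks_relators `` {w} = pres_rel weeks_relators `` {[]}"
    using inj_onD[OF inj _ class_in_carrier class_in_carrier] by (simp add: act_def)
  then have "(w, []) \<in> pres_rel weeks_relators"
    using eq_equiv_class_iff[OF equiv_pres_rel] by blast
  then show ?thesis by (simp add: pres_rel_def)
qed

lemma homeomorphic_maps_act: "homeomorphic_maps circle circle (act w) (act (formal_inverse w))"
proof -
  have "act (formal_inverse u) (act u z) = z" if "z \<in> sphere 0 1" for u z
  proof -
    have "act (formal_inverse u) (act u z) = act (formal_inverse u @ u) z"
      using that by (simp add: act_append)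
    also have "act (formal_inverse u @ u) = act []"
      by (rule act_cong) (simp add: formal_inverse_def pres_eq_inverse)
    finally show ?thesis using that by (simp add: act_Nil)
  qed
  from this this[of _ "formal_inverse w"]
  have "\<forall>z\<in>sphere 0 1. act (formal_inverse w) (act w z) = z \<and> act w (act (formal_inverse w) z) = z"
    by simp
  then show ?thesis
    unfolding homeomorphic_maps_def
    using homeomorphic_imp_continuous_map[OF homeomorphic_map_act] by simp
qed

section \<open>Lifting words to the line and preservation of orientation\<close>

definition generator_lift :: "weeks_gen \<Rightarrow> real \<Rightarrow> real" where
  "generator_lift g = (SOME f. circle_lift (act [(g, True)]) f)"

text \<open>Inverse letters get the inverse function, so free cancellation holds exactly for lifts
  and not merely up to integers.\<close>

fun letter_lift :: "weeks_gen \<times> bool \<Rightarrow> real \<Rightarrow> real" where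
  "letter_lift (g, s) = (if s then generator_lift g else inv_into UNIV (generator_lift g))"

fun word_lift :: "weeks_gen word \<Rightarrow> real \<Rightarrow> real" where
  "word_lift [] x = x"
| "word_lift (l # w) x = letter_lift l (word_lift w x)"

lemma word_lift_append: "word_lift (u @ v) x = word_lift u (word_lift v x)"
  by (induction u) auto

lemma circle_lift_generator_lift: "circle_lift (act [(g, True)]) (generator_lift g)"
proof -
  have "continuous_map circle circle (act [(g, True)])"
    using homeomorphic_map_act homeomorphic_imp_continuous_map by blast
  then have "\<exists>f. circle_lift (act [(g, True)]) f"
    by (metis circle_lift_exists)
  then show ?thesis
    unfolding generator_lift_def by (rule someI_ex)
qed

lemmas generator_lift_homeomorphism =
  circle_lift_homeomorphism[OF homeomorphic_maps_act circle_lift_generator_lift]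

lemma letter_lift_cancel [simp]: "letter_lift (g, s) (letter_lift (g, \<not> s) x) = x"
  using generator_lift_homeomorphism(1)[of g]
  by (cases s) (simp_all add: bij_is_inj bij_is_surj surj_f_inv_f)

lemma circle_lift_letter_lift: "circle_lift (act [l]) (letter_lift l)"
proof (cases l)
  case (Pair g s)
  then show ?thesis
    using circle_lift_generator_lift[of g] generator_lift_homeomorphism(2)[of g] by (cases s) simp_all
qed

lemma circle_lift_word_lift: "circle_lift (act w) (word_lift w)"
proof (induction w)
  case Nil
  show ?case using circle_lift_id[OF act_Nil] by (simp add: circle_lift_def)
next
  case (Cons l w)
  have "circle_lift (act (l # w)) (\<lambda>x. letter_lift l (word_lift w x))"
    by (rule circle_lift_comp[OF circle_lift_letter_lift Cons]) (use act_append[of _ "[l]" w] in simp)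
  then show ?case by simp
qed

lemma word_lift_relator_shift: "\<exists>n :: int. \<forall>x. word_lift (relator g) x = x + of_int n"
proof -
  have "act (relator g) = act []"
    using pres_eq.relator[of "relator g" weeks_relators "[]" "[]"]
    by (intro act_cong) (simp add: weeks_relators_eq)
  then have "circle_lift (act []) (word_lift (relator g))"
    using circle_lift_word_lift[of "relator g"] by simp
  then show ?thesis
    using circle_lift_unique[OF _ circle_lift_id[OF act_Nil]] by metis
qed

text \<open>Degrees multiply along a word, and a relator lifts to a translation, of degree 1. Since
  \<open>relator g\<close> has five letters in \<open>g\<close> and four in the other generator, its
  degree is that of \<open>g\<close>.\<close>

lemma generator_lift_shift: "generator_lift g (x + 1) = generator_lift g x + 1"
proof -
  obtain s :: "weeks_gen \<Rightarrow> int" where s: "\<And>g. s g = 1 \<or> s g = -1"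
    "\<And>g x. generator_lift g (x + 1) = generator_lift g x + of_int (s g)"
    using generator_lift_homeomorphism(3) by metis
  have gen: "generator_lift g (x + of_int n) = generator_lift g x + of_int (n * s g)" for g x n
    by (rule shift_of_int) (rule s(2))
  have letter: "letter_lift l (x + of_int n) = letter_lift l x + of_int (n * s (fst l))" for l x n
  proof (cases l)
    case (Pair g t)
    show ?thesis
    proof (cases t)
      case False
      obtain y where y: "x = generator_lift g y"
        using generator_lift_homeomorphism(1)[of g] by (metis bij_pointE)
      have "x + of_int n = generator_lift g (y + of_int (n * s g))"
        using s(1)[of g] unfolding gen y by auto
      then show ?thesis
        using generator_lift_homeomorphism(1)[of g] y Pair False by (simp add: bij_is_inj)
    qed (use gen Pair in simp)
  qed
  have word: "word_lift w (x + 1) = word_lift w x + of_int (\<Prod>l\<leftarrow>w. s (fst l))" for w x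
  proof (induction w)
    case (Cons l w)
    show ?case
      using letter[of l "word_lift w x"] by (simp add: Cons mult.commute)
  qed simp
  have "(\<Prod>l\<leftarrow>relator g. s (fst l)) = 1"
    using word_lift_relator_shift[of g] word[of "relator g" 0] by auto
  then have "s g = 1"
    using s(1)[of Gen_a] s(1)[of Gen_b] by (cases g) (auto simp: relator_def)
  then show ?thesis by (simp add: s(2))
qed

lemma word_lift_add_of_int: "word_lift w (x + of_int n) = word_lift w x + of_int n"
proof (induction w)
  case (Cons l w)
  obtain g t where l: "l = (g, t)" by force
  have gen: "generator_lift g (x + of_int n) = generator_lift g x + of_int n" for x
    using shift_of_int[of "generator_lift g" 1] generator_lift_shift by simp
  have "letter_lift l (x + of_int n) = letter_lift l x + of_int n" for x
  proof (cases t)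
    case False
    obtain y where y: "x = generator_lift g y"
      using generator_lift_homeomorphism(1)[of g] by (metis bij_pointE)
    show ?thesis
      using generator_lift_homeomorphism(1)[of g] gen[of y, symmetric] False l
      by (simp add: y bij_is_inj)
  qed (use gen l in simp)
  then show ?case by (simp add: Cons)
qed simp

lemma strict_mono_word_lift: "strict_mono (word_lift w)"
proof (rule circle_lift_strict_mono[OF circle_lift_word_lift])
  show "inj (word_lift w)"
    by (rule bij_is_inj[OF circle_lift_homeomorphism(1)[OF homeomorphic_maps_act circle_lift_word_lift]])
  show "word_lift w (x + 1) = word_lift w x + 1" for x
    using word_lift_add_of_int[of w x 1] by simp
qed

section \<open>The Euler class and normalized lifts\<close>

text \<open>Changing the generator lifts by integers changes this number by a multiple of 5; its
  residue is an invariant of the action.\<close>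

definition relator_shift :: "weeks_gen \<Rightarrow> int" where
  "relator_shift g = (SOME n. \<forall>x. word_lift (relator g) x = x + of_int n)"

lemma word_lift_relator: "word_lift (relator g) x = x + of_int (relator_shift g)"
  unfolding relator_shift_def using someI_ex[OF word_lift_relator_shift] by blast

text \<open>Modulo 5 this is the homomorphism to \<int>/5 with kernel \<open>K\<close>.\<close>

definition weight :: "weeks_gen word \<Rightarrow> int" where
  "weight w = relator_shift Gen_a * expo Gen_a w + relator_shift Gen_b * expo Gen_b w"

lemma weight_simps [simp]:
  "weight [] = 0"
  "weight ((g, s) # w) = (if s then relator_shift g else - relator_shift g) + weight w"
  "weight (u @ v) = weight u + weight v"
  "weight (formal_inverse w) = - weight w"
  "weight (relator g) = 5 * relator_shift g"
  by (cases g; simp add: weight_def expo_relator algebra_simps)+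

text \<open>Translating back by the possibly fractional amount \<open>weight w / 5\<close> makes the lift depend only on
  the group element; the result is multiplicative on words of weight divisible by \<open>5\<close>.\<close>

definition normalized_lift :: "weeks_gen word \<Rightarrow> real \<Rightarrow> real" where
  "normalized_lift w x = word_lift w x - of_int (weight w) / 5"

text \<open>A relator adds \<open>relator_shift g\<close> to the lift and five times as much to the
  weight, so the correction cancels it.\<close>

lemma normalized_lift_cong: "pres_eq weeks_relators u v \<Longrightarrow> normalized_lift u = normalized_lift v"
proof (induction rule: pres_eq.induct)
  case (cancel u x s v)
  show ?case
    by (simp add: fun_eq_iff normalized_lift_def word_lift_append del: letter_lift.simps)
next
  case (relator r u v)
  then obtain g where "r = relator g" by (auto simp: weeks_relators_eq)
  then show ?case
    by (simp add: fun_eq_iff normalized_lift_def word_lift_append word_lift_relator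
        word_lift_add_of_int add_divide_distrib)
qed auto

text \<open>The correction for \<open>v\<close> is an integer translation and so commutes with the
  lift of \<open>u\<close>.\<close>

lemma normalized_lift_append:
  assumes "5 dvd weight v"
  shows "normalized_lift (u @ v) = normalized_lift u \<circ> normalized_lift v"
proof
  fix x
  obtain k where k: "weight v = 5 * k" using assms by blast
  have "normalized_lift u (normalized_lift v x) = word_lift u (word_lift v x + of_int (- k)) - of_int (weight u) / 5"
    by (simp add: normalized_lift_def k)
  also have "\<dots> = normalized_lift (u @ v) x"
    unfolding word_lift_add_of_int by (simp add: normalized_lift_def word_lift_append k add_divide_distrib)
  finally show "normalized_lift (u @ v) x = (normalized_lift u \<circ> normalized_lift v) x" by simp
qed

lemma strict_mono_normalized_lift: "strict_mono (normalized_lift w)"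
  using strict_mono_word_lift[of w] by (simp add: strict_mono_def normalized_lift_def)

lemma normalized_lift_Nil [simp]: "normalized_lift [] x = x"
  by (simp add: normalized_lift_def)

section \<open>The positive cone on the kernel\<close>

definition real_order :: "real rel" where
  "real_order = (SOME r. well_order r)"

lemma well_order_real_order: "well_order real_order"
  unfolding real_order_def by (rule someI_ex) (rule well_order_on)

text \<open>\<open>normalized_lift\<close> and the residue of the weight depend only on the group
  element, so any representing word may serve; divisibility by 5 selects \<open>K\<close>.\<close>

definition positive :: "weeks \<Rightarrow> bool" where
  "positive g \<longleftrightarrow> (\<exists>w. g = abs_weeks w \<and> 5 dvd weight w \<and> first_moved_up real_order (normalized_lift w))"

lemma weeks_cone_positive: "weeks_relations a b A B \<Longrightarrow> weeks_cone a b A B positive"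
proof (intro weeks_cone.intro weeks_cone_axioms.intro)
  fix g h
  assume "positive g" "positive h"
  then obtain u v where uv: "g = abs_weeks u" "h = abs_weeks v" "5 dvd weight u" "5 dvd weight v"
    "first_moved_up real_order (normalized_lift u)" "first_moved_up real_order (normalized_lift v)"
    unfolding positive_def by blast
  have "first_moved_up real_order (normalized_lift (u @ v))"
    unfolding normalized_lift_append[OF uv(4)]
    by (rule first_moved_up_comp[OF well_order_real_order])
      (use uv strict_mono_normalized_lift in auto)
  then show "positive (g * h)"
    unfolding positive_def using uv by (intro exI[of _ "u @ v"]) (simp add: abs_weeks_append)
next
  show "\<not> positive 1"
  proof
    assume "positive 1"
    then obtain w where "1 = abs_weeks w" and w: "first_moved_up real_order (normalized_lift w)"
      unfolding positive_def by blast
    then have "normalized_lift w = normalized_lift []"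
      by (intro normalized_lift_cong) (simp add: one_weeks_def weeks.abs_eq_iff pres_eq.sym)
    then show False using w by (simp add: first_moved_up_def)
  qed
qed

text \<open>If the normalized lift were the identity, \<open>w\<close> would lift to an integer
  translation and act trivially; faithfulness would make it trivial, against its exponent
  sum.\<close>

lemma positive_total:
  assumes "5 dvd weight w" "\<not> 5 dvd expo g w"
  shows "positive (abs_weeks w) \<or> positive (abs_weeks (formal_inverse w))"
proof -
  obtain k where k: "weight w = 5 * k" using assms(1) by blast
  have "\<exists>x. normalized_lift w x \<noteq> x"
  proof (rule ccontr)
    assume "\<not> ?thesis"
    then have shift: "word_lift w x = x + of_int k" for x
      using k by (simp add: normalized_lift_def field_simps)
    have "pres_eq weeks_relators w []"
    proof (rule act_faithful)
      fix z :: complex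
      assume "z \<in> sphere 0 1"
      then obtain x where z: "z = circ x" by (rule sphere_circE)
      show "act w z = z"
        using circle_lift_word_lift[of w] unfolding circle_lift_def z by (simp add: shift)
    qed
    then show False using pres_eq_expo[of w "[]" g] assms(2) by simp
  qed
  then obtain x where x: "normalized_lift w x \<noteq> x" by blast
  have "normalized_lift (formal_inverse w) (normalized_lift w x) = x" for x
  proof -
    have "normalized_lift (formal_inverse w @ w) = normalized_lift []"
      by (rule normalized_lift_cong) (simp add: formal_inverse_def pres_eq_inverse)
    then show ?thesis
      using fun_cong[OF normalized_lift_append[OF assms(1), of "formal_inverse w"], of x] by simp
  qed
  from first_moved_up_total[OF well_order_real_order strict_mono_normalized_lift this x]
  show ?thesis
    unfolding positive_def using assms(1) by (metis dvd_minus_iff weight_simps(4))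
qed

section \<open>Excluding every possible kernel\<close>

text \<open>Up to inversion, the elements whose signs are needed have the exponent sums of
  \<open>v\<close> or of its square, so they lie in \<open>K\<close> and are nontrivial.\<close>

lemma cone_exclusion_b:
  assumes "weeks_relations (abs_weeks u) (abs_weeks v)
      (abs_weeks (formal_inverse u)) (abs_weeks (formal_inverse v))"
    and "5 dvd weight v" "\<not> 5 dvd expo g v"
  shows False
proof (rule weeks_cone.no_cone_b[OF weeks_cone_positive[OF assms(1)]])
  let ?u = "formal_inverse u" and ?v = "formal_inverse v"
  have n: "\<not> 5 dvd expo g v + expo g v" using assms(3) by presburger
  show "positive (abs_weeks v) \<or> positive (abs_weeks ?v)"
    by (rule positive_total[of _ g]) (use assms in simp_all)
  show "positive (abs_weeks u * abs_weeks v * abs_weeks ?u * abs_weeks v)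
      \<or> positive (abs_weeks ?v * abs_weeks u * abs_weeks ?v * abs_weeks ?u)"
    using positive_total[of "u @ v @ ?u @ v" g] assms(2) n
    by (simp add: abs_weeks_append mult.assoc)
  show "positive (abs_weeks ?u * abs_weeks ?v * abs_weeks u * abs_weeks ?v)
      \<or> positive (abs_weeks v * abs_weeks ?u * abs_weeks v * abs_weeks u)"
    using positive_total[of "v @ ?u @ v @ u" g] assms(2) n
    by (auto simp: abs_weeks_append mult.assoc)
qed

text \<open>Up to inversion, all five elements whose signs are needed have the exponent sums of
  \<open>u\<close> times the inverse square of \<open>v\<close>.\<close>

lemma cone_exclusion_BaB:
  assumes "weeks_relations (abs_weeks u) (abs_weeks v)
      (abs_weeks (formal_inverse u)) (abs_weeks (formal_inverse v))"
    and weight: "5 dvd weight u - 2 * weight v" and expo: "\<not> 5 dvd expo g u - 2 * expo g v"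
  shows False
proof (rule weeks_cone.no_cone_BaB[OF weeks_cone_positive[OF assms(1)]])
  let ?u = "formal_inverse u" and ?v = "formal_inverse v"
  have total: "positive (abs_weeks w) \<or> positive (abs_weeks (formal_inverse w))"
    if "weight w = weight u - 2 * weight v" "expo g w = expo g u - 2 * expo g v" for w
    by (rule positive_total[of _ g]) (simp_all add: that weight expo)
  show "positive (abs_weeks ?v * abs_weeks u * abs_weeks ?v) \<or> positive (abs_weeks v * abs_weeks ?u * abs_weeks v)"
    using total[of "?v @ u @ ?v"] by (simp add: abs_weeks_append mult.assoc)
  show "positive (abs_weeks u * abs_weeks ?v * abs_weeks u * abs_weeks ?v * abs_weeks ?u)
      \<or> positive (abs_weeks u * abs_weeks v * abs_weeks ?u * abs_weeks v * abs_weeks ?u)"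
    using total[of "u @ ?v @ u @ ?v @ ?u"] by (simp add: abs_weeks_append mult.assoc)
  show "positive (abs_weeks u * abs_weeks ?v * abs_weeks ?v) \<or> positive (abs_weeks v * abs_weeks v * abs_weeks ?u)"
    using total[of "u @ ?v @ ?v"] by (simp add: abs_weeks_append mult.assoc)
  show "positive (abs_weeks ?u * abs_weeks v * abs_weeks ?u * abs_weeks v * abs_weeks u)
      \<or> positive (abs_weeks ?u * abs_weeks ?v * abs_weeks u * abs_weeks ?v * abs_weeks u)"
    using total[of "?u @ ?v @ u @ ?v @ u"] by (auto simp: abs_weeks_append mult.assoc)
  show "positive (abs_weeks ?u * abs_weeks v * abs_weeks v) \<or> positive (abs_weeks ?v * abs_weeks ?v * abs_weeks u)"
    using total[of "?v @ ?v @ u"] by (auto simp: abs_weeks_append mult.assoc)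
qed

text \<open>Modulo 5, the form \<open>j * x + i * y\<close> on exponent sums vanishes on at least
  one of the six lines of (\<int>/5)\<times>(\<int>/5); the six cases name a vector on each.\<close>

lemma no_faithful_action: False
proof -
  define i j where "i = relator_shift Gen_b" and "j = relator_shift Gen_a"
  note rel = weeks_relations_generators
  note relations = rel weeks_relations.swap[OF rel] weeks_relations.shear[OF rel]
    weeks_relations.swap[OF weeks_relations.shear[OF rel]]
  have "5 dvd i \<or> 5 dvd j \<or> 5 dvd j - i \<or> 5 dvd j - 2 * i \<or> 5 dvd i - 2 * j \<or> 5 dvd i + j"
    by presburger
  then consider "5 dvd i" | "5 dvd j" | "5 dvd j - i" | "5 dvd j - 2 * i" | "5 dvd i - 2 * j" | "5 dvd i + j"
    by blast
  then show False
  proof cases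
    case 1
    then show ?thesis
      using cone_exclusion_b[of "[(Gen_a, True)]" "[(Gen_b, True)]" Gen_b] relations
      by (simp add: abs_weeks_word i_def)
  next
    case 2
    then show ?thesis
      using cone_exclusion_b[of "[(Gen_b, True)]" "[(Gen_a, True)]" Gen_a] relations
      by (simp add: abs_weeks_word j_def)
  next
    case 3
    then show ?thesis
      using cone_exclusion_b[of "[(Gen_a, True)]" "[(Gen_a, True), (Gen_b, False)]" Gen_a] relations
      by (simp add: abs_weeks_word i_def j_def)
  next
    case 4
    then show ?thesis
      using cone_exclusion_BaB[of "[(Gen_a, True)]" "[(Gen_b, True)]" Gen_a] relations
      by (simp add: abs_weeks_word i_def j_def)
  next
    case 5
    then show ?thesis
      using cone_exclusion_BaB[of "[(Gen_b, True)]" "[(Gen_a, True)]" Gen_b] relations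
      by (simp add: abs_weeks_word i_def j_def)
  next
    case 6
    \<comment> \<open>For the pair \<open>a * B\<close>, \<open>a\<close>, the weight tested is
      \<open>(j - i) - 2 * j = - (i + j)\<close>.\<close>
    then have "5 dvd j + - i - 2 * j" by presburger
    then show ?thesis
      using cone_exclusion_BaB[of "[(Gen_a, True), (Gen_b, False)]" "[(Gen_a, True)]" Gen_a] relations
      by (simp add: abs_weeks_word i_def j_def)
  qed
qed

end

theorem theorem9p2:
  shows "\<not> (\<exists>\<phi>. \<phi> \<in> hom weeks_group (Homeo circle) \<and> inj_on \<phi> (carrier weeks_group))"
proof
  assume "\<exists>\<phi>. \<phi> \<in> hom weeks_group (Homeo circle) \<and> inj_on \<phi> (carrier weeks_group)"
  then obtain \<phi> where "faithful_weeks_action \<phi>"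
    by (auto intro: faithful_weeks_action.intro)
  then show False
    by (rule faithful_weeks_action.no_faithful_action)
qed

end
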